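(* Let $\boldsymbol X_1,\ldots,\boldsymbol X_n\in\mathbb R^d$ and let $$\mathcal Q:=\{(\psi(\boldsymbol X_1),\ldots,\psi(\boldsymbol X_n)):\ \psi:\mathbb R^d\to\mathbb R\text{ quasiconvex and decreasing}\}\subseteq\mathbb R^n.$$ A vector $\boldsymbol z\in\mathbb R^n$ belongs to $\mathcal Q$ if and only if there exist vectors $\boldsymbol\xi_1,\ldots,\boldsymbol\xi_n\in[0,\infty)^d$ such that $$\boldsymbol\xi_j^\top(\boldsymbol X_i-\boldsymbol X_j)>0\quad\text{for every } i,j\in\{1,\ldots,n\}\text{ such that } z_i<z_j .$$
   Context: For $\boldsymbol a,\boldsymbol b\in\mathbb R^d$, $\boldsymbol a\le\boldsymbol b$ means $a_i\le b_i$ for all $i$. $\psi:\mathbb R^d\to\mathbb R$ is quasiconvex if $\psi(\lambda\boldsymbol x+(1-\lambda)\boldsymbol y)\le\max\{\psi(\boldsymbol x),\psi(\boldsymbol y)\}$ for all $\boldsymbol x,\boldsymbol y$ and $\lambda\in[0,1]$, and decreasing if $\psi(\boldsymbol x)\ge\psi(\boldsymbol y)$ whenever $\boldsymbol x\le\boldsymbol y$. *)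

theory Defs
  imports "HOL-Analysis.Analysis"
begin

definition quasiconvex :: "('a::real_vector \<Rightarrow> real) \<Rightarrow> bool" where
  "quasiconvex \<psi> \<longleftrightarrow>
     (\<forall>x y. \<forall>u\<in>{0..1}. \<psi> (u *\<^sub>R x + (1 - u) *\<^sub>R y) \<le> max (\<psi> x) (\<psi> y))"

(* The order on real ^ 'd is the componentwise one (less_eq_vec_def), so antimono
   means non-increasing with respect to the componentwise order. *)
definition quasiconvex_decreasing_values :: "('n::finite \<Rightarrow> real ^ 'd::finite) \<Rightarrow> (real ^ 'n) set" where
  "quasiconvex_decreasing_values X = {(\<chi> i. \<psi> (X i)) |\<psi>. quasiconvex \<psi> \<and> antimono \<psi>}"

end

theory Submission
  imports Defs
begin

text \<open>
  For necessity, the convex hull of the points \<open>X i\<close> with \<open>z i < z j\<close> is compact and, by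
  quasiconvexity and monotonicity, disjoint from the closed convex orthant of points below \<open>X j\<close>.
  A strictly separating functional is nonnegative because the orthant is unbounded below.
  For sufficiency, the maximum of the step functions that equal \<open>z j\<close> on the half-space
  \<open>\<xi> j \<bullet> (x - X j) \<le> 0\<close> and the least entry of \<open>z\<close> elsewhere interpolates \<open>z\<close>.
\<close>

lemma quasiconvex_convex_strict_sublevel:
  assumes "quasiconvex \<psi>"
  shows "convex {x. \<psi> x < c}"
proof (rule convexI)
  fix x y and u v :: real
  assume xy: "x \<in> {x. \<psi> x < c}" "y \<in> {x. \<psi> x < c}" and u: "0 \<le> u" "0 \<le> v" "u + v = 1"
  have v: "v = 1 - u" and "u \<in> {0..1}" using u by auto
  then have "\<psi> (u *\<^sub>R x + v *\<^sub>R y) \<le> max (\<psi> x) (\<psi> y)"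
    using assms unfolding quasiconvex_def v by blast
  then show "u *\<^sub>R x + v *\<^sub>R y \<in> {x. \<psi> x < c}"
    using xy by auto
qed

text \<open>If both endpoints lie in the open half-space where the value is \<open>m\<close>, so
  does the whole segment. Otherwise one endpoint already has the value \<open>c\<close>, which is
  the larger one by \<open>m \<le> c\<close>.\<close>

lemma quasiconvex_step:
  fixes a :: "'a::real_inner"
  assumes "m \<le> c"
  shows "quasiconvex (\<lambda>x. if a \<bullet> x \<le> b then c else m)"
  unfolding quasiconvex_def
proof (intro allI ballI)
  fix x y and u :: real
  assume u: "u \<in> {0..1}"
  have "b < a \<bullet> (u *\<^sub>R x + (1 - u) *\<^sub>R y)" if "b < a \<bullet> x" "b < a \<bullet> y"
    using convexD[OF convex_halfspace_gt, of x b a y u "1 - u"] that u by simp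
  then show "(if a \<bullet> (u *\<^sub>R x + (1 - u) *\<^sub>R y) \<le> b then c else m)
      \<le> max (if a \<bullet> x \<le> b then c else m) (if a \<bullet> y \<le> b then c else m)"
    using assms by (auto simp: not_le max_def)
qed

lemma quasiconvex_Max:
  fixes f :: "'i::finite \<Rightarrow> 'a::real_vector \<Rightarrow> real"
  assumes "\<And>i. quasiconvex (f i)"
  shows "quasiconvex (\<lambda>x. MAX i. f i x)"
  unfolding quasiconvex_def
proof (intro allI ballI)
  fix x y and u :: real
  assume u: "u \<in> {0..1}"
  have "f i (u *\<^sub>R x + (1 - u) *\<^sub>R y) \<le> max (MAX i. f i x) (MAX i. f i y)" for i
  proof -
    have "f i (u *\<^sub>R x + (1 - u) *\<^sub>R y) \<le> max (f i x) (f i y)"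
      using assms[of i] u unfolding quasiconvex_def by blast
    also have "\<dots> \<le> max (MAX i. f i x) (MAX i. f i y)"
      by (intro max.mono Max_ge) auto
    finally show ?thesis .
  qed
  then show "(MAX i. f i (u *\<^sub>R x + (1 - u) *\<^sub>R y)) \<le> max (MAX i. f i x) (MAX i. f i y)"
    by (subst Max_le_iff) auto
qed

lemma antimono_Max:
  fixes f :: "'i::finite \<Rightarrow> 'a::order \<Rightarrow> real"
  assumes "\<And>i. antimono (f i)"
  shows "antimono (\<lambda>x. MAX i. f i x)"
proof (rule antimonoI)
  fix x y :: 'a
  assume "x \<le> y"
  have "f i y \<le> (MAX i. f i x)" for i
  proof -
    have "f i y \<le> f i x" using assms \<open>x \<le> y\<close> by (rule antimonoD)
    also have "\<dots> \<le> (MAX i. f i x)" by (rule Max_ge) auto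
    finally show ?thesis .
  qed
  then show "(MAX i. f i y) \<le> (MAX i. f i x)"
    by (subst Max_le_iff) auto
qed

lemma inner_mono_nonneg_vec:
  fixes a x y :: "real ^ 'd::finite"
  assumes "\<And>k. 0 \<le> a $ k" "x \<le> y"
  shows "a \<bullet> x \<le> a \<bullet> y"
  using assms by (auto simp: inner_vec_def less_eq_vec_def intro!: sum_mono mult_left_mono)

lemma nonneg_separator_of_orthant:
  fixes K :: "(real ^ 'd::finite) set"
  assumes "convex K" "compact K" and disj: "\<And>p. p \<in> K \<Longrightarrow> \<not> p \<le> q"
  obtains a where "\<And>k. 0 \<le> a $ k" "\<And>p. p \<in> K \<Longrightarrow> a \<bullet> (p - q) > 0"
proof (cases "K = {}")
  case True
  \<comment> \<open>An empty \<open>K\<close> arises when \<open>z j\<close> is a least entry; the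
    zero vector then serves, as there is nothing to separate.\<close>
  then show ?thesis using that[of 0] by simp
next
  case False
  have "{..q} = (\<Inter>k. {x. x $ k \<le> q $ k})"
    by (auto simp: less_eq_vec_def)
  then have "closed {..q}"
    by (auto intro!: closed_INT closed_Collect_le continuous_intros)
  moreover have "convex {..q}"
    by (rule convexI)
      (auto simp: less_eq_vec_def intro!: convex_bound_le)
  moreover have "{..q} \<inter> K = {}" using disj by auto
  ultimately have "\<exists>a b. (\<forall>x\<in>{..q}. a \<bullet> x < b) \<and> (\<forall>x\<in>K. b < a \<bullet> x)"
    using assms(1,2) False by (intro separating_hyperplane_closed_compact) simp_all
  then obtain a b where a: "\<And>x. x \<le> q \<Longrightarrow> a \<bullet> x < b" "\<And>x. x \<in> K \<Longrightarrow> b < a \<bullet> x"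
    unfolding Ball_def atMost_iff by blast
  have "0 \<le> a $ k" for k
  proof (rule ccontr)
    assume neg: "\<not> 0 \<le> a $ k"
    \<comment> \<open>Lowering coordinate \<open>k\<close> of \<open>q\<close> by \<open>t\<close>
      raises the functional by \<open>- t * a $ k\<close>. This \<open>t\<close> makes the value
      exactly \<open>b\<close>, at a point that is still below \<open>q\<close>, against the strict
      bound there.\<close>
    define t where "t = (b - a \<bullet> q) / (- a $ k)"
    have "t \<ge> 0" unfolding t_def using a(1)[of q] neg by (intro divide_nonneg_pos) auto
    then have "q - t *\<^sub>R axis k 1 \<le> q"
      by (auto simp: less_eq_vec_def axis_def)
    then have "a \<bullet> (q - t *\<^sub>R axis k 1) < b" by (rule a(1))
    moreover have "a \<bullet> (q - t *\<^sub>R axis k 1) = b"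
      using neg by (simp add: inner_diff_right inner_add_right inner_axis t_def)
    ultimately show False by simp
  qed
  moreover have "a \<bullet> (p - q) > 0" if "p \<in> K" for p
    using a(1)[of q] a(2)[OF that] by (simp add: inner_diff_right)
  ultimately show ?thesis by (rule that)
qed

theorem lemma3p5:
  fixes X :: "'n::finite \<Rightarrow> real ^ 'd::finite" and z :: "real ^ 'n"
  shows "z \<in> quasiconvex_decreasing_values X \<longleftrightarrow>
    (\<exists>\<xi> :: 'n \<Rightarrow> real ^ 'd. (\<forall>j k. 0 \<le> \<xi> j $ k) \<and>
      (\<forall>i j. z $ i < z $ j \<longrightarrow> \<xi> j \<bullet> (X i - X j) > 0))"
proof
  assume "z \<in> quasiconvex_decreasing_values X"
  then obtain \<psi> where \<psi>: "quasiconvex \<psi>" "antimono \<psi>" and z: "\<And>i. z $ i = \<psi> (X i)"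
    unfolding quasiconvex_decreasing_values_def by auto
  have "\<exists>a. (\<forall>k. 0 \<le> a $ k) \<and> (\<forall>i. z $ i < z $ j \<longrightarrow> a \<bullet> (X i - X j) > 0)" for j
  proof -
    define K where "K = convex hull (X ` {i. z $ i < z $ j})"
    \<comment> \<open>The strict sublevel set is convex and contains the generators, hence their
      hull. A point below \<open>X j\<close> cannot lie in it, because \<psi> is decreasing.\<close>
    have "K \<subseteq> {x. \<psi> x < \<psi> (X j)}"
      unfolding K_def using quasiconvex_convex_strict_sublevel[OF \<psi>(1)]
      by (intro hull_minimal) (auto simp: z)
    then have "\<not> p \<le> X j" if "p \<in> K" for p
      using that antimonoD[OF \<psi>(2), of p "X j"] by auto
    moreover have "convex K" "compact K"
      unfolding K_def by (simp_all add: finite_imp_compact_convex_hull)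
    ultimately obtain a where a: "\<And>k. 0 \<le> a $ k" "\<And>p. p \<in> K \<Longrightarrow> a \<bullet> (p - X j) > 0"
      using nonneg_separator_of_orthant[of K "X j"] by blast
    have "X i \<in> K" if "z $ i < z $ j" for i
      unfolding K_def using that by (auto intro: hull_inc)
    with a show ?thesis by blast
  qed
  then show "\<exists>\<xi> :: 'n \<Rightarrow> real ^ 'd. (\<forall>j k. 0 \<le> \<xi> j $ k) \<and>
      (\<forall>i j. z $ i < z $ j \<longrightarrow> \<xi> j \<bullet> (X i - X j) > 0)"
    by metis
next
  assume "\<exists>\<xi> :: 'n \<Rightarrow> real ^ 'd. (\<forall>j k. 0 \<le> \<xi> j $ k) \<and>
      (\<forall>i j. z $ i < z $ j \<longrightarrow> \<xi> j \<bullet> (X i - X j) > 0)"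
  then obtain \<xi> :: "'n \<Rightarrow> real ^ 'd" where \<xi>: "\<And>j k. 0 \<le> \<xi> j $ k"
    "\<And>i j. z $ i < z $ j \<Longrightarrow> \<xi> j \<bullet> (X i - X j) > 0"
    by blast
  \<comment> \<open>The least entry is a safe default: it keeps each step function quasiconvex and
    decreasing, and it never exceeds the target value at any \<open>X i\<close>.\<close>
  define m where "m = (MIN i. z $ i)"
  have m: "m \<le> z $ i" for i unfolding m_def by (rule Min_le) auto
  define f where "f j x = (if \<xi> j \<bullet> x \<le> \<xi> j \<bullet> X j then z $ j else m)" for j x
  define \<psi> where "\<psi> x = (MAX j. f j x)" for x
  have "quasiconvex \<psi>"
    unfolding \<psi>_def f_def by (intro quasiconvex_Max quasiconvex_step m)
  moreover have "antimono (f j)" for j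
  proof (rule antimonoI)
    fix x y :: "real ^ 'd"
    assume "x \<le> y"
    \<comment> \<open>Moving up can only leave the half-space, so the value can only drop from
      \<open>z $ j\<close> to \<open>m\<close>.\<close>
    then have "\<xi> j \<bullet> x \<le> \<xi> j \<bullet> y" by (intro inner_mono_nonneg_vec \<xi>)
    then show "f j y \<le> f j x" using m[of j] by (simp add: f_def)
  qed
  then have "antimono \<psi>"
    unfolding \<psi>_def by (rule antimono_Max)
  moreover have "\<psi> (X i) = z $ i" for i
    unfolding \<psi>_def
  proof (rule Max_eqI)
    \<comment> \<open>The point \<open>X i\<close> lies on the boundary of its own half-space, which
      is closed, so \<open>f i\<close> attains \<open>z $ i\<close> there.\<close>
    show "z $ i \<in> range (\<lambda>j. f j (X i))"
      by (rule range_eqI[of _ _ i]) (simp add: f_def)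
    \<comment> \<open>If \<open>z $ i < z $ j\<close>, the hypothesis on \<xi> puts
      \<open>X i\<close> outside the half-space of \<open>j\<close>, where the value is
      \<open>m\<close>. Otherwise both possible values are at most \<open>z $ i\<close>.\<close>
    have "f j (X i) \<le> z $ i" for j
      using m[of i] \<xi>(2)[of i j] by (cases "z $ i < z $ j") (auto simp: f_def inner_diff_right)
    then show "y \<le> z $ i" if "y \<in> range (\<lambda>j. f j (X i))" for y
      using that by auto
  qed simp
  ultimately show "z \<in> quasiconvex_decreasing_values X"
    unfolding quasiconvex_decreasing_values_def by (auto simp: vec_eq_iff intro!: exI[of _ \<psi>])
qed

end
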